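(* Let $\gamma>0$, $\varepsilon>0$, let $k_2,k_3$ be positive integers, let $D_+,D_-,M$ be a one-dimensional periodic upwind SBP operator with $\mathtt{ndof}$ degrees of freedom, let $(\circ,\diamond)$ be either $(+,-)$ or $(-,+)$, and let $g(c)=\frac14(c^2-1)^2$. Let $\mathbf w=(\varsigma,\mathbf q,w,\mathbf p,\varphi)$ (each component a function of $t$ with values in $\mathbb R^{\mathtt{ndof}}$) be a solution of $$\varsigma_t+D_\circ\Big(\frac{\mathbf q}{\varepsilon^{k_3}}\Big)=0,\qquad \mathbf q_t+D_\diamond\Big(g'(\varsigma)+\frac{\varsigma-\varphi}{\varepsilon}\Big)=-\frac{\mathbf q}{\varepsilon^{k_3}},\qquad w_t-D_\circ(\gamma\mathbf p)=\frac{\varsigma-\varphi}{\varepsilon},$$ $$\mathbf p_t-\frac{D_\diamond w}{\gamma\varepsilon^{k_2}}=0,\qquad \varphi_t=\frac{w}{\gamma\varepsilon^{k_2}}.$$ Then the energy $$\mathcal E_{H,d}(\mathbf w)=1^TM\,g(\varsigma)+\frac\gamma2\|\mathbf p\|_M^2+\frac{\|\varsigma-\varphi\|_M^2}{2\varepsilon}+\frac{\|w\|_M^2}{2\gamma\varepsilon^{k_2}}+\frac{1}{2\varepsilon^{k_3}}\|\mathbf q\|_M^2$$ is dissipative, i.e. $$\frac{\mathrm d}{\mathrm dt}\mathcal E_{H,d}(\mathbf w)\le0.$$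
   Context: Periodic upwind SBP operator (one space dimension): matrices $D_+,D_-\in\mathbb R^{\mathtt{ndof}\times\mathtt{ndof}}$ consistent with the first derivative (in particular $D_\pm1=0$) and a symmetric positive definite, diagonal mass matrix $M\in\mathbb R^{\mathtt{ndof}\times\mathtt{ndof}}$ such that $MD_+=-D_-^TM$. Here $1$ is the vector of ones, $\|y\|_M^2:=y^TMy$, and $g$, $g'$ are applied componentwise to vectors. *)

theory Defs
  imports "HOL-Analysis.Analysis"
begin

definition diagonal :: "real^'n^'n \<Rightarrow> bool" where
  "diagonal A \<longleftrightarrow> (\<forall>i j. i \<noteq> j \<longrightarrow> A $ i $ j = 0)"

definition sym_pos_def :: "real^'n^'n \<Rightarrow> bool" where
  "sym_pos_def A \<longleftrightarrow> transpose A = A \<and> (\<forall>x. x \<noteq> 0 \<longrightarrow> x \<bullet> (A *v x) > 0)"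

text \<open>The number of degrees of freedom is \<open>CARD('n)\<close>, and \<open>1 :: real^'n\<close> is the vector of
  ones. A periodic grid carries no global nonconstant monomials, so consistency of a matrix with
  the first derivative means that constants are differentiated exactly.\<close>

definition consistent_first_derivative :: "real^'n^'n \<Rightarrow> bool" where
  "consistent_first_derivative D \<longleftrightarrow> D *v 1 = 0"

definition periodic_upwind_SBP :: "real^'n^'n \<Rightarrow> real^'n^'n \<Rightarrow> real^'n^'n \<Rightarrow> bool" where
  "periodic_upwind_SBP Dp Dm M \<longleftrightarrow>
     consistent_first_derivative Dp \<and> consistent_first_derivative Dm \<and>
     sym_pos_def M \<and> diagonal M \<and>
     M ** Dp = - (transpose Dm ** M)"

definition mass_norm_sq :: "real^'n^'n \<Rightarrow> real^'n \<Rightarrow> real" where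
  "mass_norm_sq M y = y \<bullet> (M *v y)"

definition componentwise :: "(real \<Rightarrow> real) \<Rightarrow> real^'n \<Rightarrow> real^'n" where
  "componentwise f x = (\<chi> i. f (x $ i))"

definition g :: "real \<Rightarrow> real" where
  "g c = 1/4 * (c^2 - 1)^2"

text \<open>The time derivatives are taken within the time set \<open>I\<close>, hence one-sided at an end point
  that belongs to \<open>I\<close>. They are uniquely determined if \<open>I\<close> is a nondegenerate interval. The
  matrices \<open>Da\<close> and \<open>Db\<close> stand for \<open>D\<^sub>\<circ>\<close> and \<open>D\<^sub>\<diamond>\<close>.\<close>

definition semidiscrete_solution ::
  "real \<Rightarrow> real \<Rightarrow> nat \<Rightarrow> nat \<Rightarrow> real^'n^'n \<Rightarrow> real^'n^'n \<Rightarrow> real set \<Rightarrow>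
   (real \<Rightarrow> real^'n) \<Rightarrow> (real \<Rightarrow> real^'n) \<Rightarrow> (real \<Rightarrow> real^'n) \<Rightarrow> (real \<Rightarrow> real^'n) \<Rightarrow>
   (real \<Rightarrow> real^'n) \<Rightarrow> bool" where
  "semidiscrete_solution \<gamma> \<epsilon> k2 k3 Da Db I \<sigma> q w p \<phi> \<longleftrightarrow>
     (\<forall>t\<in>I.
        \<sigma> differentiable (at t within I) \<and>
        q differentiable (at t within I) \<and>
        w differentiable (at t within I) \<and>
        p differentiable (at t within I) \<and>
        \<phi> differentiable (at t within I) \<and>
        vector_derivative \<sigma> (at t within I) + Da *v (q t /\<^sub>R \<epsilon> ^ k3) = 0 \<and>
        vector_derivative q (at t within I)
          + Db *v (componentwise (deriv g) (\<sigma> t) + (\<sigma> t - \<phi> t) /\<^sub>R \<epsilon>) = - (q t /\<^sub>R \<epsilon> ^ k3) \<and>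
        vector_derivative w (at t within I) - Da *v (\<gamma> *\<^sub>R p t) = (\<sigma> t - \<phi> t) /\<^sub>R \<epsilon> \<and>
        vector_derivative p (at t within I) - (Db *v w t) /\<^sub>R (\<gamma> * \<epsilon> ^ k2) = 0 \<and>
        vector_derivative \<phi> (at t within I) = w t /\<^sub>R (\<gamma> * \<epsilon> ^ k2))"

definition energy ::
  "real \<Rightarrow> real \<Rightarrow> nat \<Rightarrow> nat \<Rightarrow> real^'n^'n \<Rightarrow>
   real^'n \<Rightarrow> real^'n \<Rightarrow> real^'n \<Rightarrow> real^'n \<Rightarrow> real^'n \<Rightarrow> real" where
  "energy \<gamma> \<epsilon> k2 k3 M \<sigma> q w p \<phi> =
     1 \<bullet> (M *v componentwise g \<sigma>)
     + \<gamma> / 2 * mass_norm_sq M p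
     + mass_norm_sq M (\<sigma> - \<phi>) / (2 * \<epsilon>)
     + mass_norm_sq M w / (2 * \<gamma> * \<epsilon> ^ k2)
     + 1 / (2 * \<epsilon> ^ k3) * mass_norm_sq M q"

end

theory Submission
  imports Defs
begin

text \<open>In the inner product \<open>x\<^sup>T M y\<close> the operators \<open>D\<^sub>\<circ>\<close> and \<open>D\<^sub>\<diamond>\<close> are negative adjoints of each
  other, and since \<open>M\<close> is diagonal, the derivative of \<open>1\<^sup>T M g(\<sigma>)\<close> is \<open>g'(\<sigma>)\<^sup>T M \<sigma>\<^sub>t\<close>. Testing the
  equations with the variational derivatives of the energy therefore makes all coupling terms
  cancel in pairs, and only the relaxation term \<open>- \<parallel>q\<parallel>\<^sub>M\<^sup>2 / \<epsilon>\<^bsup>2 k3\<^esup>\<close> survives.\<close>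

text \<open>Named as a form of its own so that a single \<open>bounded_bilinear\<close> fact
  supplies both the linearity rules and the product rule.\<close>

definition mass_inner :: "real^'n^'n \<Rightarrow> real^'n \<Rightarrow> real^'n \<Rightarrow> real" where
  "mass_inner M x y = x \<bullet> (M *v y)"

lemma bounded_bilinear_mass_inner: "bounded_bilinear (mass_inner M)"
  unfolding mass_inner_def
  using bounded_bilinear.comp[OF bounded_bilinear_inner bounded_linear_ident
      matrix_vector_mul_bounded_linear[of M]] by simp

lemmas mass_inner_simps =
  bounded_bilinear.add_left[OF bounded_bilinear_mass_inner]
  bounded_bilinear.add_right[OF bounded_bilinear_mass_inner]
  bounded_bilinear.diff_left[OF bounded_bilinear_mass_inner]
  bounded_bilinear.diff_right[OF bounded_bilinear_mass_inner]
  bounded_bilinear.minus_left[OF bounded_bilinear_mass_inner]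
  bounded_bilinear.minus_right[OF bounded_bilinear_mass_inner]
  bounded_bilinear.scaleR_left[OF bounded_bilinear_mass_inner]
  bounded_bilinear.scaleR_right[OF bounded_bilinear_mass_inner]

lemma mass_inner_commute:
  assumes "transpose M = M"
  shows "mass_inner M x y = mass_inner M y x"
  unfolding mass_inner_def
  using assms by (metis dot_lmul_matrix inner_commute vector_transpose_matrix)

lemma mass_inner_diagonal:
  assumes "diagonal M"
  shows "mass_inner M x y = (\<Sum>i\<in>UNIV. M $ i $ i * x $ i * y $ i)"
proof -
  have "(M *v y) $ i = M $ i $ i * y $ i" for i
  proof -
    have "(M *v y) $ i = (\<Sum>j\<in>UNIV. if j = i then M $ i $ i * y $ i else 0)"
      unfolding matrix_vector_mult_def using assms
      \<comment> \<open>With the \<open>sum.delta\<close> rules active the right-hand sum would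
        collapse; kept as a sum, it can be compared termwise with row \<open>i\<close> of
        \<open>M\<close>.\<close>
      by (simp del: sum.delta sum.delta') (rule sum.cong, auto simp: diagonal_def)
    then show ?thesis by simp
  qed
  then show ?thesis
    by (simp add: mass_inner_def inner_vec_def algebra_simps)
qed

text \<open>Discrete integration by parts: a periodic grid has no boundary terms, so the matrix
  identity makes \<open>Dp\<close> and \<open>Dm\<close> negative adjoints.\<close>

lemma SBP_mass_inner:
  assumes "M ** Dp = - (transpose Dm ** M)"
  shows "mass_inner M x (Dp *v y) = - mass_inner M (Dm *v x) y"
proof -
  have "M *v (Dp *v y) = - (transpose Dm *v (M *v y))"
    by (simp add: matrix_vector_mul_assoc assms) (simp add: vec_eq_iff matrix_vector_mult_def sum_negf)
  then show ?thesis
    by (simp add: mass_inner_def inner_commute[of x] dot_lmul_matrix inner_commute[of "M *v y"])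
qed

text \<open>The product rule yields two terms, which the symmetry of \<open>M\<close> identifies;
  hence the factor 2.\<close>

lemma has_real_derivative_mass_norm_sq:
  assumes "transpose M = M" and "(f has_vector_derivative f') (at t within I)"
  shows "((\<lambda>s. mass_norm_sq M (f s)) has_real_derivative 2 * mass_inner M (f t) f')
    (at t within I)"
proof -
  have "((\<lambda>s. mass_inner M (f s) (f s)) has_vector_derivative
      mass_inner M (f t) f' + mass_inner M f' (f t)) (at t within I)"
    by (rule bounded_bilinear.has_vector_derivative[OF bounded_bilinear_mass_inner assms(2,2)])
  then show ?thesis
    using mass_inner_commute[OF assms(1), of f' "f t"]
    by (simp add: has_real_derivative_iff_has_vector_derivative mass_norm_sq_def mass_inner_def)
qed

text \<open>For diagonal \<open>M\<close> the quantity is a weighted sum of the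
  \<open>f (x $ i)\<close>, so the scalar chain rule applies in each component. The same weights
  then reassemble into the mass inner product.\<close>

lemma has_real_derivative_mass_componentwise:
  assumes "diagonal M"
    and "\<And>c. f field_differentiable (at c)"
    and "(x has_vector_derivative x') (at t within I)"
  shows "((\<lambda>s. 1 \<bullet> (M *v componentwise f (x s))) has_real_derivative
      mass_inner M (componentwise (deriv f) (x t)) x') (at t within I)"
proof -
  have "((\<lambda>s. M $ i $ i * f (x s $ i)) has_real_derivative
      M $ i $ i * (deriv f (x t $ i) * x' $ i)) (at t within I)" for i
  proof -
    have "((\<lambda>s. x s $ i) has_real_derivative x' $ i) (at t within I)"
      using bounded_linear.has_vector_derivative[OF bounded_linear_vec_nth assms(3)]
      by (simp add: has_real_derivative_iff_has_vector_derivative)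
    then have "((\<lambda>s. f (x s $ i)) has_real_derivative deriv f (x t $ i) * x' $ i) (at t within I)"
      using assms(2) by (intro DERIV_chain2[where f = f]) (auto simp: DERIV_deriv_iff_field_differentiable)
    then show ?thesis by (rule DERIV_cmult)
  qed
  then have "((\<lambda>s. \<Sum>i\<in>UNIV. M $ i $ i * f (x s $ i)) has_real_derivative
      (\<Sum>i\<in>UNIV. M $ i $ i * (deriv f (x t $ i) * x' $ i))) (at t within I)"
    by (intro DERIV_sum) auto
  moreover have "1 \<bullet> (M *v componentwise f (x s)) = (\<Sum>i\<in>UNIV. M $ i $ i * f (x s $ i))" for s
    using mass_inner_diagonal[OF assms(1), of 1 "componentwise f (x s)"]
    by (simp add: mass_inner_def componentwise_def)
  moreover have "mass_inner M (componentwise (deriv f) (x t)) x' =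
      (\<Sum>i\<in>UNIV. M $ i $ i * (deriv f (x t $ i) * x' $ i))"
    by (simp add: mass_inner_diagonal[OF assms(1)] componentwise_def mult.assoc)
  ultimately show ?thesis by simp
qed

lemma g_field_differentiable: "g field_differentiable (at c)"
  unfolding g_def field_differentiable_def by (auto intro!: derivative_eq_intros)

text \<open>The differential equations do not enter yet. The derivative keeps the unsimplified shape
  produced by the rules, which is the left-hand side of \<open>energy_rate\<close>.\<close>

lemma has_real_derivative_energy:
  assumes "diagonal M" and "transpose M = M"
    and "(\<sigma> has_vector_derivative \<sigma>') (at t within I)"
    and "(q has_vector_derivative q') (at t within I)"
    and "(w has_vector_derivative w') (at t within I)"
    and "(p has_vector_derivative p') (at t within I)"
    and "(\<phi> has_vector_derivative \<phi>') (at t within I)"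
  shows "((\<lambda>s. energy \<gamma> \<epsilon> k2 k3 M (\<sigma> s) (q s) (w s) (p s) (\<phi> s)) has_real_derivative
      mass_inner M (componentwise (deriv g) (\<sigma> t)) \<sigma>'
      + \<gamma> / 2 * (2 * mass_inner M (p t) p')
      + 2 * mass_inner M (\<sigma> t - \<phi> t) (\<sigma>' - \<phi>') / (2 * \<epsilon>)
      + 2 * mass_inner M (w t) w' / (2 * \<gamma> * \<epsilon> ^ k2)
      + 1 / (2 * \<epsilon> ^ k3) * (2 * mass_inner M (q t) q')) (at t within I)"
  unfolding energy_def
  by (intro DERIV_add DERIV_cmult DERIV_cdivide has_real_derivative_mass_norm_sq
      has_real_derivative_mass_componentwise g_field_differentiable
      has_vector_derivative_diff assms)

text \<open>Pure algebra at a fixed time: the primed variables are vectors given by the equations,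
  and \<open>v\<close> stands for the componentwise derivative of \<open>g\<close> at
  \<sigma>.\<close>

lemma energy_rate:
  fixes M Da Db :: "real^'n^'n"
  assumes "\<gamma> \<noteq> 0" and "\<epsilon> \<noteq> 0" and sym: "transpose M = M"
    and SBP: "\<And>x y. mass_inner M x (Da *v y) = - mass_inner M (Db *v x) y"
    and \<sigma>': "\<sigma>' = - (Da *v (q /\<^sub>R \<epsilon> ^ k3))"
    and q': "q' = - (q /\<^sub>R \<epsilon> ^ k3) - Db *v (v + (\<sigma> - \<phi>) /\<^sub>R \<epsilon>)"
    and w': "w' = (\<sigma> - \<phi>) /\<^sub>R \<epsilon> + Da *v (\<gamma> *\<^sub>R p)"
    and p': "p' = (Db *v w) /\<^sub>R (\<gamma> * \<epsilon> ^ k2)"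
    and \<phi>': "\<phi>' = w /\<^sub>R (\<gamma> * \<epsilon> ^ k2)"
  shows "mass_inner M v \<sigma>' + \<gamma> / 2 * (2 * mass_inner M p p')
      + 2 * mass_inner M (\<sigma> - \<phi>) (\<sigma>' - \<phi>') / (2 * \<epsilon>)
      + 2 * mass_inner M w w' / (2 * \<gamma> * \<epsilon> ^ k2)
      + 1 / (2 * \<epsilon> ^ k3) * (2 * mass_inner M q q')
    = - (mass_inner M q q / (\<epsilon> ^ k3)\<^sup>2)"
proof -
  define d where "d = \<sigma> - \<phi>"
  define E2 E3 where "E2 = \<epsilon> ^ k2" and "E3 = \<epsilon> ^ k3"
  have nz: "E2 \<noteq> 0" "E3 \<noteq> 0" using assms(2) by (auto simp: E2_def E3_def)
  note comm = mass_inner_commute[OF sym]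
  \<comment> \<open>Each \<open>Da\<close> is moved to the other argument as \<open>Db\<close>, and
    symmetry fixes the order of the arguments, so that equal couplings become syntactically
    equal.\<close>
  have v: "mass_inner M v \<sigma>' = mass_inner M q (Db *v v) / E3"
    by (simp add: \<sigma>' SBP mass_inner_simps comm[of "Db *v v"] E3_def field_simps)
  have d: "mass_inner M d (\<sigma>' - \<phi>') = mass_inner M q (Db *v d) / E3 - mass_inner M w d / (\<gamma> * E2)"
    by (simp add: \<sigma>' \<phi>' SBP mass_inner_simps comm[of "Db *v d"] comm[of d w] E2_def E3_def field_simps)
  have p: "mass_inner M p p' = mass_inner M p (Db *v w) / (\<gamma> * E2)"
    by (simp add: p' mass_inner_simps E2_def field_simps)
  have w: "mass_inner M w w' = mass_inner M w d / \<epsilon> - \<gamma> * mass_inner M p (Db *v w)"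
    by (simp add: w' SBP mass_inner_simps comm[of "Db *v w"] field_simps flip: d_def)
  have q: "mass_inner M q q' =
      - mass_inner M q q / E3 - mass_inner M q (Db *v v) - mass_inner M q (Db *v d) / \<epsilon>"
    by (simp add: q' mass_inner_simps matrix_vector_right_distrib matrix_vector_mult_scaleR
        flip: d_def E3_def) (simp add: field_simps)
  show ?thesis
    \<comment> \<open>After weighting, the \<open>Db *v v\<close> and \<open>Db *v d\<close> terms
      of \<open>q\<close> cancel those of \<open>v\<close> and \<open>d\<close>, the
      \<open>Db *v w\<close> terms of \<open>p\<close> and \<open>w\<close> cancel, and so do the
      pairings of \<open>w\<close> with \<open>d\<close>.\<close>
    unfolding d_def[symmetric] E2_def[symmetric] E3_def[symmetric] v d p w q
    using assms(1,2) nz by (simp add: field_simps power2_eq_square)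
qed

theorem lemma18:
  fixes \<gamma> \<epsilon> :: real and k2 k3 :: nat
    and Dp Dm M Da Db :: "real^'n^'n"
    and I :: "real set"
    and \<sigma> q w p \<phi> :: "real \<Rightarrow> real^'n"
  assumes "\<gamma> > 0" and "\<epsilon> > 0" and "k2 > 0" and "k3 > 0"
    and "periodic_upwind_SBP Dp Dm M"
    and "(Da, Db) = (Dp, Dm) \<or> (Da, Db) = (Dm, Dp)"
    and "is_interval I" and "interior I \<noteq> {}"
    and "semidiscrete_solution \<gamma> \<epsilon> k2 k3 Da Db I \<sigma> q w p \<phi>"
  shows "\<forall>t\<in>I. \<exists>E'.
           ((\<lambda>s. energy \<gamma> \<epsilon> k2 k3 M (\<sigma> s) (q s) (w s) (p s) (\<phi> s)) has_real_derivative E')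
             (at t within I) \<and> E' \<le> 0"
proof
  fix t assume "t \<in> I"
  note sol = assms(9)[unfolded semidiscrete_solution_def, rule_format, OF \<open>t \<in> I\<close>]
  have diag: "diagonal M" and sym: "transpose M = M"
    and pos: "\<And>x. x \<noteq> 0 \<Longrightarrow> mass_inner M x x > 0"
    and SBP0: "M ** Dp = - (transpose Dm ** M)"
    using assms(5) by (auto simp: periodic_upwind_SBP_def sym_pos_def_def mass_inner_def)
  have adj: "mass_inner M x (Dp *v y) = - mass_inner M (Dm *v x) y" for x y
    by (rule SBP_mass_inner[OF SBP0])
  \<comment> \<open>Symmetry of \<open>M\<close> makes the adjointness relation invariant under
    exchanging \<open>Dp\<close> and \<open>Dm\<close>, so both choices of \<open>(Da, Db)\<close>
    are covered.\<close>
  have "mass_inner M x (Dm *v y) = - mass_inner M (Dp *v x) y" for x y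
    using adj[of y x] mass_inner_commute[OF sym] by simp
  with adj assms(6) have SBP: "mass_inner M x (Da *v y) = - mass_inner M (Db *v x) y" for x y
    by auto
  let ?d = "\<lambda>f. vector_derivative f (at t within I)"
  have ders: "(\<sigma> has_vector_derivative ?d \<sigma>) (at t within I)"
    "(q has_vector_derivative ?d q) (at t within I)"
    "(w has_vector_derivative ?d w) (at t within I)"
    "(p has_vector_derivative ?d p) (at t within I)"
    "(\<phi> has_vector_derivative ?d \<phi>) (at t within I)"
    using sol unfolding vector_derivative_works[symmetric] by blast+
  have eqs: "?d \<sigma> = - (Da *v (q t /\<^sub>R \<epsilon> ^ k3))"
    "?d q = - (q t /\<^sub>R \<epsilon> ^ k3)
      - Db *v (componentwise (deriv g) (\<sigma> t) + (\<sigma> t - \<phi> t) /\<^sub>R \<epsilon>)"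
    "?d w = (\<sigma> t - \<phi> t) /\<^sub>R \<epsilon> + Da *v (\<gamma> *\<^sub>R p t)"
    "?d p = (Db *v w t) /\<^sub>R (\<gamma> * \<epsilon> ^ k2)"
    "?d \<phi> = w t /\<^sub>R (\<gamma> * \<epsilon> ^ k2)"
    using sol by (simp_all only: eq_neg_iff_add_eq_0 eq_diff_eq diff_eq_eq add_0_left)
  have "0 \<le> mass_inner M (q t) (q t)"
    \<comment> \<open>Positive definiteness speaks only of nonzero vectors; at zero the form
      vanishes.\<close>
    using pos[of "q t"] by (cases "q t = 0") (auto simp: mass_inner_def)
  then have "- (mass_inner M (q t) (q t) / (\<epsilon> ^ k3)\<^sup>2) \<le> 0"
    by simp
  moreover have "((\<lambda>s. energy \<gamma> \<epsilon> k2 k3 M (\<sigma> s) (q s) (w s) (p s) (\<phi> s)) has_real_derivative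
      - (mass_inner M (q t) (q t) / (\<epsilon> ^ k3)\<^sup>2)) (at t within I)"
    by (rule DERIV_cong[OF has_real_derivative_energy[OF diag sym ders] energy_rate[OF _ _ sym SBP eqs]])
      (use assms(1,2) in simp_all)
  ultimately show "\<exists>E'.
      ((\<lambda>s. energy \<gamma> \<epsilon> k2 k3 M (\<sigma> s) (q s) (w s) (p s) (\<phi> s)) has_real_derivative E')
        (at t within I) \<and> E' \<le> 0"
    by blast
qed

end
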